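(* Let $k \geq 2$ and let $G = (\{a,b\}, \varphi, a)$ be a circular D0L-system in which the morphism $\varphi$ is $k$-uniform. Let $d$ denote the least divisor of $k$ greater than $1$. Then the minimal synchronizing delay $Z_{\min}$ of $G$ satisfies: (i) $Z_{\min} \leq 8$ if $k = 2$; (ii) $Z_{\min} \leq k^2 + 3k - 4$ if $k$ is an odd prime; (iii) $Z_{\min} \leq k^2\left(\frac{k}{d} - 1\right) + 5k - 4$ otherwise.
   Context: A D0L-system is a triple $G=(\mathcal{A},\varphi,w)$ with $\mathcal{A}$ a finite alphabet, $\varphi:\mathcal{A}^*\to\mathcal{A}^*$ a morphism and $w\in\mathcal{A}^+$ (the axiom). Its language is $L(G)=\{\varphi^n(w): n\in\mathbb{N}\}$ and $S(L(G))$ is the set of all factors of words of $L(G)$; the alphabet is assumed minimal, i.e. every letter of $\mathcal{A}$ belongs to $S(L(G))$. $G$ is a PD0L-system if $\varphi(c)\neq\varepsilon$ for all $c\in\mathcal{A}$. $G$ is injective on $S(L(G))$ if $\varphi(u)=\varphi(v)$ with $u,v\in S(L(G))$ implies $u=v$. For $u\in S(L(G))$, an interpretation of $u$ is a triple $(p,v,s)$ with $p,s\in\mathcal{A}^*$, $v\in S(L(G))$ and $\varphi(v)=pus$. Writing $v=v_1\cdots v_n$, $v'=v'_1\cdots v'_m$, $u=u_1\cdots u_\ell$ (letters), two interpretations $(p,v,s)$, $(p',v',s')$ of $u$ are synchronized at position $j$ ($0\le j\le \ell$) if there are indices $i,i'$ with $\varphi(v_1\cdots v_i)=p\,u_1\cdots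 u_j$ and $\varphi(v'_1\cdots v'_{i'})=p'\,u_1\cdots u_j$ (empty products are $\varepsilon$). The word $u$ has a synchronizing point at position $j$ if all its interpretations are pairwise synchronized at position $j$. A PD0L-system injective on $S(L(G))$ is circular if there is a positive integer $Z$ (a synchronizing delay) such that every $u\in S(L(G))$ with $|u|>Z$ has a synchronizing point; $Z_{\min}$ denotes the least such $Z$. A morphism $\varphi$ on $\{a,b\}$ is $k$-uniform if $|\varphi(a)|=|\varphi(b)|=k$. *)

theory Defs
  imports Main "HOL-Computational_Algebra.Primes"
begin

datatype letter = a | b

definition morph :: "('c \<Rightarrow> 'c list) \<Rightarrow> 'c list \<Rightarrow> 'c list" where
  "morph f u = concat (map f u)"

definition lang :: "('c \<Rightarrow> 'c list) \<Rightarrow> 'c list \<Rightarrow> 'c list set" where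
  "lang f w = {(morph f ^^ n) w | n. True}"

definition factors :: "'c list set \<Rightarrow> 'c list set" where
  "factors L = {u. \<exists>x\<in>L. \<exists>p s. x = p @ u @ s}"

definition SL :: "('c \<Rightarrow> 'c list) \<Rightarrow> 'c list \<Rightarrow> 'c list set" where
  "SL f w = factors (lang f w)"

definition minimal_alphabet :: "('c \<Rightarrow> 'c list) \<Rightarrow> 'c list \<Rightarrow> bool" where
  "minimal_alphabet f w \<longleftrightarrow> (\<forall>c. [c] \<in> SL f w)"

definition PD0L :: "('c \<Rightarrow> 'c list) \<Rightarrow> 'c list \<Rightarrow> bool" where
  "PD0L f w \<longleftrightarrow> w \<noteq> [] \<and> minimal_alphabet f w \<and> (\<forall>c. f c \<noteq> [])"

definition injective_on_SL :: "('c \<Rightarrow> 'c list) \<Rightarrow> 'c list \<Rightarrow> bool" where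
  "injective_on_SL f w \<longleftrightarrow>
     (\<forall>u\<in>SL f w. \<forall>v\<in>SL f w. morph f u = morph f v \<longrightarrow> u = v)"

definition interp :: "('c \<Rightarrow> 'c list) \<Rightarrow> 'c list \<Rightarrow> 'c list \<Rightarrow> 'c list \<times> 'c list \<times> 'c list \<Rightarrow> bool" where
  "interp f w u I \<longleftrightarrow>
     (case I of (p, v, s) \<Rightarrow> v \<in> SL f w \<and> morph f v = p @ u @ s)"

definition synchronized_at :: "('c \<Rightarrow> 'c list) \<Rightarrow> 'c list \<Rightarrow> nat \<Rightarrow>
    'c list \<times> 'c list \<times> 'c list \<Rightarrow> 'c list \<times> 'c list \<times> 'c list \<Rightarrow> bool" where
  "synchronized_at f u j I I' \<longleftrightarrow>
     (case I of (p, v, s) \<Rightarrow> case I' of (p', v', s') \<Rightarrow>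
        (\<exists>i \<le> length v. \<exists>i' \<le> length v'.
           morph f (take i v) = p @ take j u \<and> morph f (take i' v') = p' @ take j u))"

definition sync_point :: "('c \<Rightarrow> 'c list) \<Rightarrow> 'c list \<Rightarrow> 'c list \<Rightarrow> nat \<Rightarrow> bool" where
  "sync_point f w u j \<longleftrightarrow> j \<le> length u \<and>
     (\<forall>I I'. interp f w u I \<longrightarrow> interp f w u I' \<longrightarrow> synchronized_at f u j I I')"

definition sync_delay :: "('c \<Rightarrow> 'c list) \<Rightarrow> 'c list \<Rightarrow> nat \<Rightarrow> bool" where
  "sync_delay f w Z \<longleftrightarrow> Z > 0 \<and>
     (\<forall>u\<in>SL f w. length u > Z \<longrightarrow> (\<exists>j. sync_point f w u j))"

definition circular :: "('c \<Rightarrow> 'c list) \<Rightarrow> 'c list \<Rightarrow> bool" where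
  "circular f w \<longleftrightarrow> PD0L f w \<and> injective_on_SL f w \<and> (\<exists>Z. sync_delay f w Z)"

definition Z_min :: "('c \<Rightarrow> 'c list) \<Rightarrow> 'c list \<Rightarrow> nat" where
  "Z_min f w = (LEAST Z. sync_delay f w Z)"

definition uniform :: "nat \<Rightarrow> (letter \<Rightarrow> letter list) \<Rightarrow> bool" where
  "uniform k f \<longleftrightarrow> length (f a) = k \<and> length (f b) = k"

end

theory Submission
  imports Defs "HOL-Number_Theory.Cong"
begin

text \<open>
  For a \<open>k\<close>-uniform morphism, a long word \<open>u\<close> without a synchronizing point is covered by \<open>f v\<close> and
  by \<open>f v'\<close> with block boundaries shifted by some \<open>0 < r < k\<close>, so every inner block satisfies
  \<open>f (v' ! j) = drop r (f (v ! j)) @ take r (f (v ! Suc j))\<close>. On two letters this forces \<open>v\<close> to be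
  alternating or a power \<open>x\<^sup>n\<close> of a letter up to one letter at an end; in the latter case \<open>v'\<close>
  is essentially a power of a letter \<open>y\<close> whose image is a rotation of \<open>f x\<close>.

  If \<open>v\<close> alternates, then \<open>f a @ f b\<close> is a power of a word whose length is less than \<open>k\<close> and does
  not divide \<open>k\<close>, and it turns out to alternate itself, so that all alternating words are factors
  and circularity fails. If \<open>x \<noteq> y\<close>, a letter count bounds the total length of the two runs by \<open>2k\<close>.
  If \<open>x = y\<close>, then \<open>f x\<close> is a power of a shorter word \<open>w\<close>, with \<open>length w\<close> dividing \<open>k\<close>. Circularity
  excludes \<open>f x = x\<^sup>k\<close>. If \<open>f x\<close> is the \<open>k\<close>-th power of the other letter, or if no image is \<open>x\<^sup>k\<close>,
  runs of \<open>x\<close> are short. Otherwise the other letter \<open>z\<close> has \<open>f z = x\<^sup>k\<close>, and a run of \<open>x\<close> comes from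
  a run of \<open>z\<close>, which \<open>w\<close> bounds: this is the source of the term \<open>k\<^sup>2 (k div d - 1)\<close>.
\<close>

section \<open>Words\<close>

lemma comm_power:
  assumes "s @ p = p @ s"
  shows "s @ concat (replicate n p) = concat (replicate n p) @ s"
proof (induction n)
  case (Suc n)
  have "s @ concat (replicate (Suc n) p) = p @ s @ concat (replicate n p)"
    using assms by (metis append.assoc concat.simps(2) replicate_Suc)
  then show ?case using Suc by simp
qed simp

text \<open>By \<open>comm_power\<close>, a word commuting with a nonempty \<open>p\<close> is a
  prefix of every long enough power of \<open>p\<close>, so its length determines it.\<close>

lemma comm_unique:
  assumes "s @ p = p @ s" "t @ p = p @ t" "length s = length t" "p \<noteq> []"
  shows "s = t"
proof -
  have len: "length s \<le> length (concat (replicate (length s) p))"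
    using assms(4) by (cases p) (auto simp: length_concat sum_list_replicate)
  have "s = take (length s) (concat (replicate (length s) p))"
    using comm_power[OF assms(1), of "length s"] len
    by (metis append_eq_append_conv_if append_eq_conv_conj take_all_iff)
  moreover have "t = take (length s) (concat (replicate (length s) p))"
    using comm_power[OF assms(2), of "length s"] len assms(3)
    by (metis append_eq_append_conv_if append_eq_conv_conj take_all_iff)
  ultimately show ?thesis by simp
qed

lemma length_concat_replicate: "length (concat (replicate n w)) = n * length w"
  by (induction n) auto

lemma nth_concat_replicate:
  assumes "i < n * length w"
  shows "concat (replicate n w) ! i = w ! (i mod length w)"
  using assms
proof (induction n arbitrary: i)
  case (Suc n)
  then show ?case
    by (cases "i < length w") (auto simp: nth_append le_mod_geq)
qed simp

lemma comm_root:
  assumes "x @ y = y @ x" "x \<noteq> []"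
  obtains w m n where "w \<noteq> []" "x = concat (replicate m w)" "x @ y = concat (replicate n w)"
proof -
  obtain m n w where "concat (replicate m w) = x" "concat (replicate n w) = y"
    using comm_append_are_replicate[OF assms(1)] by blast
  moreover from this have "w \<noteq> []" using assms(2) by (induction m arbitrary: x) auto
  ultimately show thesis
    using that[of w m "m + n"] by (simp add: replicate_add)
qed

lemma count_replicate: "count_list (replicate m x) x = m"
  by (induction m) auto

lemma letter_neq_iff: "x \<noteq> a \<longleftrightarrow> x = b" "x \<noteq> b \<longleftrightarrow> x = a"
  by (cases x; simp)+

lemma letter_neq_unique: "y \<noteq> x \<Longrightarrow> z \<noteq> x \<Longrightarrow> y = z" for x y z :: letter
  by (cases x; cases y; cases z) auto

lemma distinct_adj_letter_unique:
  fixes xs ys :: "letter list"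
  assumes "distinct_adj xs" "distinct_adj ys" "length xs = length ys" "hd xs = hd ys"
  shows "xs = ys"
  using assms(3,1,2,4)
proof (induction xs ys rule: list_induct2)
  case (Cons x xs y ys)
  show ?case
  proof (cases xs)
    case (Cons x' xs')
    then obtain y' ys' where "ys = y' # ys'" using Cons.hyps by (cases ys) auto
    then show ?thesis
      using Cons.prems Cons.IH \<open>xs = x' # xs'\<close>
      by (cases x; cases x'; cases y') auto
  qed (use Cons in auto)
qed simp

lemma distinct_adj_prefix: "distinct_adj (xs @ ys) \<Longrightarrow> distinct_adj xs"
  and distinct_adj_suffix: "distinct_adj (xs @ ys) \<Longrightarrow> distinct_adj ys"
  by (auto simp: distinct_adj_append_iff)

lemma distinct_adj_nth:
  "distinct_adj xs \<longleftrightarrow> (\<forall>i. Suc i < length xs \<longrightarrow> xs ! i \<noteq> xs ! Suc i)"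
  by (simp add: distinct_adj_def successively_conv_nth)

text \<open>The first \<open>min t l\<close> positions of the run have distinct residues modulo
  \<open>l\<close>, none of them in \<open>R\<close>. As \<open>R\<close> is nonempty, fewer than
  \<open>l\<close> residues remain, so the minimum is \<open>t\<close>.\<close>

lemma run_avoids_residues:
  assumes "z = p @ replicate t x @ s" "R \<subseteq> {..<l}" "R \<noteq> {}"
    and "\<And>i. i < length z \<Longrightarrow> i mod l \<in> R \<Longrightarrow> z ! i \<noteq> x"
  shows "t + card R \<le> l"
proof -
  let ?g = "\<lambda>i. (length p + i) mod l"
  let ?I = "{..<min t l}"
  have l: "l > 0" using assms(2,3) by (cases l) auto
  have "inj_on ?g ?I"
  proof (rule inj_onI)
    fix i j assume ij: "i \<in> ?I" "j \<in> ?I" "?g i = ?g j"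
    then have "[length p + i = length p + j] (mod l)" by (simp add: cong_def)
    then have "[i = j] (mod l)" by (simp only: cong_add_lcancel_nat)
    then show "i = j" using ij by (simp add: cong_def)
  qed
  then have c1: "card (?g ` ?I) = min t l" by (simp add: card_image)
  have "?g ` ?I \<inter> R = {}"
  proof -
    have "?g i \<notin> R" if "i \<in> ?I" for i
      using assms(4)[of "length p + i"] that by (auto simp: assms(1) nth_append)
    then show ?thesis by auto
  qed
  moreover have "?g ` ?I \<subseteq> {..<l}" using l by auto
  moreover have fin: "finite R" "finite (?g ` ?I)" using assms(2) finite_subset by auto
  ultimately have "card (?g ` ?I) + card R \<le> card {..<l}"
    using assms(2) by (metis (no_types, lifting) Un_least card_Un_disjoint card_mono finite_lessThan)
  moreover have "card R > 0" using assms(3) fin by auto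
  ultimately show ?thesis using c1 by auto
qed

section \<open>Uniform morphisms\<close>

lemma morph_simps [simp]:
  "morph f [] = []" "morph f (c # v) = f c @ morph f v"
  "morph f (u @ v) = morph f u @ morph f v"
  by (simp_all add: morph_def)

locale uniform_morphism =
  fixes k :: nat and f :: "letter \<Rightarrow> letter list"
  assumes k2: "2 \<le> k" and len [simp]: "length (f c) = k"
begin

lemma length_morph [simp]: "length (morph f v) = k * length v"
  by (induction v) auto

lemma morph_replicate: "f y = replicate k x \<Longrightarrow> morph f (replicate n y) = replicate (k * n) x"
  by (induction n) (auto simp: replicate_add[symmetric])

lemma take_morph: "take (k * i) (morph f v) = morph f (take i v)"
proof (induction v arbitrary: i)
  case (Cons c v)
  then show ?case by (cases i) auto
qed simp

lemma drop_morph: "drop (k * i) (morph f v) = morph f (drop i v)"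
proof (induction v arbitrary: i)
  case (Cons c v)
  then show ?case by (cases i) auto
qed simp

lemma nth_morph:
  assumes "j < length v" "i < k"
  shows "morph f v ! (k * j + i) = f (v ! j) ! i"
  using assms
proof (induction v arbitrary: j)
  case (Cons c v)
  then show ?case by (cases j) (auto simp: nth_append)
qed simp

lemma nth_morph':
  assumes "i < length (morph f v)"
  shows "morph f v ! i = f (v ! (i div k)) ! (i mod k)"
proof -
  have "i div k < length v" "i mod k < k"
    using assms k2 by (simp_all add: less_mult_imp_div_less mult.commute)
  from nth_morph[OF this] show ?thesis by simp
qed

section \<open>Coverings of a word by blocks\<close>

text \<open>Dropping the letters of \<open>v\<close> whose images lie entirely inside
  \<open>p\<close> or \<open>s\<close> keeps the block boundaries in \<open>u\<close>. Every
  interpretation thus reduces to one that overhangs \<open>u\<close> by less than a block on each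
  side.\<close>

lemma trim:
  assumes "morph f v = p @ u @ s"
  obtains v1 v2 v3 p' s' where "v = v1 @ v2 @ v3" "morph f v2 = p' @ u @ s'"
    "length p' = length p mod k" "length s' < k"
proof -
  define i where "i = length p div k"
  define m where "m = length v - length s div k"
  have lens: "length p + length u + length s = k * length v"
    using arg_cong[OF assms, of length] by simp
  have p: "k * i \<le> length p" "length p - k * i = length p mod k"
    by (simp_all add: i_def minus_mult_div_eq_mod)
  have "length s \<le> k * length v" using lens by linarith
  then have sle: "length s div k \<le> length v"
    using k2 div_le_mono[of "length s" "k * length v" k] by simp
  then have "k * (length s div k) \<le> k * length v" by simp
  then have km: "k * m + length s = k * length v + length s mod k"
    using mult_div_mod_eq[of k "length s"] by (simp only: m_def diff_mult_distrib2)
  have smod: "length s mod k < k" using k2 by simp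
  define s' where "s' = take (length s mod k) s"
  have "morph f (take m v) = take (k * m) (p @ u @ s)"
    by (simp add: take_morph assms[symmetric])
  also have "k * m = length p + length u + length s mod k" using km lens by linarith
  also have "take \<dots> (p @ u @ s) = p @ u @ s'" by (simp add: s'_def)
  finally have t: "morph f (take m v) = p @ u @ s'" .
  have "morph f (drop i (take m v)) = drop (k * i) p @ u @ s'"
    using p by (simp only: drop_morph[symmetric] t) simp
  moreover have "v = take i (take m v) @ drop i (take m v) @ drop m v" 
    by (metis append.assoc append_take_drop_id)
  ultimately show thesis
    using that[of _ _ _ "drop (k * i) p" s'] p smod by (simp add: s'_def)
qed

text \<open>At most \<open>k - 1\<close> letters of \<open>u\<close> precede its first block
  boundary, so \<open>2 * k - 1\<close> letters leave room for a whole block.\<close>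

lemma contains_block:
  assumes "morph f v = p @ u @ s" "2 * k - 1 \<le> length u"
  obtains c x y where "u = x @ f c @ y"
proof -
  obtain v1 v2 v3 p' s' where "v = v1 @ v2 @ v3" and v2: "morph f v2 = p' @ u @ s'"
    "length p' = length p mod k" "length s' < k" using trim[OF assms(1)] .
  then have p': "length p' < k" using k2 by simp
  \<comment> \<open>Block 0 of \<open>v2\<close> lies wholly in \<open>u\<close> only if
    \<open>u\<close> starts at a block boundary; otherwise block 1 is the first candidate.\<close>
  define i where "i = (if p' = [] then 0 else 1::nat)"
  have i: "length p' \<le> k * i" "k * i + k \<le> length p' + length u"
    using p' assms(2) k2 by (cases p'; simp add: i_def)+
  have "k * Suc i \<le> k * length v2"
    using i(2) arg_cong[OF v2(1), of length] by simp
  then have il: "i < length v2" using k2 by (simp only: mult_le_cancel1) simp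
  have "morph f (take 1 (drop i v2)) = take k (drop (k * i) (p' @ u @ s'))"
    using take_morph[of 1 "drop i v2"] by (simp add: drop_morph[symmetric] v2(1))
  also have "\<dots> = take k (drop (k * i - length p') u)"
    using i by simp
  also have "morph f (take 1 (drop i v2)) = f (v2 ! i)"
    using il by (simp add: take_Suc hd_drop_conv_nth)
  finally have "u = take (k * i - length p') u @ f (v2 ! i) @ drop k (drop (k * i - length p') u)"
    by (metis append_take_drop_id)
  then show thesis by (rule that)
qed

text \<open>With the two coverings laid over \<open>u\<close>, block \<open>j\<close> of
  \<open>v'\<close> starts \<open>r\<close> letters after the start of block \<open>j\<close> of
  \<open>v\<close>. It thus consists of the rest of that block and the first \<open>r\<close>
  letters of the next. The condition \<open>0 < j\<close> skips block 0, which may begin before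
  \<open>u\<close>.\<close>

lemma overlap:
  assumes "morph f v = p @ u @ s" "morph f v' = p' @ u @ s'"
    and p: "length p' < length p" "length p < k"
    and j: "0 < j" "k * Suc j \<le> length u"
  defines "r \<equiv> length p - length p'"
  shows "Suc j < length v" "j < length v'"
    "f (v' ! j) = drop r (f (v ! j)) @ take r (f (v ! Suc j))"
proof -
  have l: "k * length v = length p + length u + length s"
      "k * length v' = length p' + length u + length s'"
    using arg_cong[OF assms(1), of length] arg_cong[OF assms(2), of length] by simp_all
  have "k * Suc j < k * length v" using j p l by linarith
  then show v: "Suc j < length v" by (simp only: mult_less_cancel1)
  have "k * j < k * length v'" using j p l k2 by simp
  then show v': "j < length v'" by simp
  have kj: "k \<le> k * j" using j by simp
  show "f (v' ! j) = drop r (f (v ! j)) @ take r (f (v ! Suc j))"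
  proof (rule nth_equalityI)
    show "length (f (v' ! j)) = length (drop r (f (v ! j)) @ take r (f (v ! Suc j)))"
      using p by (simp add: r_def)
    fix i assume "i < length (f (v' ! j))"
    then have i: "i < k" by simp
    define n where "n = k * j + i - length p'"
    have "length p' \<le> k * j + i" using kj p by linarith
    then have n: "k * j + i = length p' + n" "k * j + i + r = length p + n" "n < length u"
      using i j(2) p by (simp_all add: n_def r_def)
    have "f (v' ! j) ! i = u ! n"
      using nth_morph[OF v' i] n by (simp add: assms(2) nth_append)
    also have "\<dots> = morph f v ! (k * j + i + r)"
      unfolding n(2) using n(3) by (simp add: assms(1) nth_append)
    also have "\<dots> = (drop r (f (v ! j)) @ take r (f (v ! Suc j))) ! i"
    proof (cases "i + r < k")
      case True
      then have "i < k - r" by simp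
      then have "(drop r (f (v ! j)) @ take r (f (v ! Suc j))) ! i = f (v ! j) ! (r + i)"
        by (simp add: nth_append)
      moreover have "morph f v ! (k * j + (r + i)) = f (v ! j) ! (r + i)"
        using nth_morph[of j v "r + i"] v True by simp
      ultimately show ?thesis by (simp only: add.assoc add.commute[of i r])
    next
      case False
      define m where "m = i + r - k"
      have m: "k * j + i + r = k * Suc j + m" "i = (k - r) + m" "m < r" "r < k"
        using False i p by (simp_all add: m_def r_def)
      have "(drop r (f (v ! j)) @ take r (f (v ! Suc j))) ! i = take r (f (v ! Suc j)) ! m"
        using nth_append_length_plus[of "drop r (f (v ! j))" "take r (f (v ! Suc j))" m]
        by (simp only: m(2)) simp
      then show ?thesis using nth_morph[of "Suc j" v m] v m(3,4) by (simp only: m(1)) simp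
    qed
    finally show "f (v' ! j) ! i = (drop r (f (v ! j)) @ take r (f (v ! Suc j))) ! i" .
  qed
qed

text \<open>A run of \<open>x\<close> cannot contain a whole block, so it meets at most two blocks,
  each with \<open>n\<close> copies of \<open>x\<close>.\<close>

lemma run_bound_mixed:
  assumes "morph f v = p @ replicate m x @ s"
    and "\<And>c. f c \<noteq> replicate k x" "\<And>c. count_list (f c) x = n"
  shows "m \<le> 2 * n"
proof -
  obtain v1 v2 v3 p' s' where "v = v1 @ v2 @ v3" and v2: "morph f v2 = p' @ replicate m x @ s'"
    "length p' = length p mod k" "length s' < k" using trim[OF assms(1)] .
  then have p': "length p' < k" using k2 by simp
  have "length v2 \<le> 2"
  proof (rule ccontr)
    assume "\<not> length v2 \<le> 2"
    then obtain c1 c2 c3 v3 where v2c: "v2 = c1 # c2 # c3 # v3"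
      by (auto simp: not_le numeral_2_eq_2 Suc_le_length_iff Suc_le_eq[symmetric])
    have l: "k * length v2 = length p' + m + length s'"
      using arg_cong[OF v2(1), of length] by simp
    have le: "length p' + m \<ge> 2 * k" using l v2(3) by (simp add: v2c)
    have "take k (drop k (morph f v2)) = f c2" by (simp add: v2c)
    also have "take k (drop k (morph f v2)) = replicate k x"
      using p' le by (simp add: v2(1))
    finally show False using assms(2) by metis
  qed
  then have "count_list (morph f v2) x \<le> 2 * n"
    by (cases v2; cases "tl v2") (auto simp: assms(3))
  then show ?thesis
    by (simp add: v2(1) count_replicate)
qed

text \<open>The two rotations differ, so \<open>c\<close> and \<open>d\<close> differ: the rotation
  by \<open>r\<close> either fixes both images or exchanges them. If it fixes them, each prefix
  commutes with its suffix. If it exchanges them and, say, the prefix \<open>p\<close> is shared,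
  both suffixes commute with \<open>p @ p\<close>. Then \<open>comm_unique\<close> identifies the
  two images.\<close>

lemma no_common_overhang:
  assumes "f a \<noteq> f b" "0 < r" "r < k"
    and "f c = drop r (f a) @ take r (f a)" "f d = drop r (f b) @ take r (f b)"
    and "take r (f a) = take r (f b) \<or> drop r (f a) = drop r (f b)"
  shows False
proof -
  define p s p' s' where ps: "p = take r (f a)" "s = drop r (f a)" "p' = take r (f b)" "s' = drop r (f b)"
  have f: "f a = p @ s" "f b = p' @ s'" by (simp_all add: ps)
  have l: "length p = r" "length p' = r" "length s = k - r" "length s' = k - r"
    using assms(3) by (simp_all add: ps)
  have ne: "p \<noteq> []" "s \<noteq> []" using l assms(2,3) by auto
  have fc: "f c = s @ p" "f d = s' @ p'" using assms(4,5) by (simp_all add: ps)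
  have eq: "p = p' \<or> s = s'" using assms(6) by (simp add: ps)
  then have "s @ p \<noteq> s' @ p'" using assms(1) l by (auto simp: f)
  then have "c \<noteq> d" using fc by auto
  then consider "c = a" "d = b" | "c = b" "d = a" by (cases c; cases d) auto
  then have "s = s' \<and> p = p'"
  proof cases
    case 1
    then have sp: "s @ p = p @ s" "s' @ p' = p' @ s'" using f fc by metis+
    show ?thesis using eq
    proof
      assume P: "p = p'"
      show ?thesis using comm_unique[OF sp(1) sp(2)[folded P] _ ne(1)] l P by simp
    next
      assume S: "s = s'"
      show ?thesis
        using comm_unique[OF sp(1)[symmetric] sp(2)[symmetric, folded S] _ ne(2)] l S by simp
    qed
  next
    case 2
    then have e: "s @ p = p' @ s'" "s' @ p' = p @ s" using f fc by metis+
    show ?thesis using eq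
    proof
      assume P: "p = p'"
      have "s @ p @ p = p @ p @ s" "s' @ p @ p = p @ p @ s'"
        using e unfolding P[symmetric] by (metis append.assoc)+
      then show ?thesis using comm_unique[of s "p @ p" s'] P l ne by (simp only: append.assoc) simp
    next
      assume S: "s = s'"
      have "p @ s @ s = s @ s @ p" "p' @ s @ s = s @ s @ p'"
        using e unfolding S[symmetric] by (metis append.assoc)+
      then show ?thesis using comm_unique[of p "s @ s" p'] S l ne by (simp only: append.assoc) simp
    qed
  qed
  then show False using assms(1) f by simp
qed

text \<open>If the prefixes of length \<^term>\<open>r\<close> and the complementary suffixes both differ, then the
  words \<^term>\<open>drop r (f c) @ take r (f d)\<close> are pairwise distinct, so that only two pairs
  \<^term>\<open>(c, d)\<close> can occur.\<close>

lemma overlap_structure: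
  assumes "f a \<noteq> f b" "0 < r" "r < k"
    and rel: "\<And>j. 1 \<le> j \<Longrightarrow> j < N \<Longrightarrow> f (h' j) = drop r (f (h j)) @ take r (f (h (Suc j)))"
  shows "(\<forall>j. 1 \<le> j \<and> j < N \<longrightarrow> h j \<noteq> h (Suc j)) \<or>
    (\<exists>x. (\<forall>j. 1 \<le> j \<and> j < N \<longrightarrow> h j = x) \<or> (\<forall>j. 1 \<le> j \<and> j < N \<longrightarrow> h (Suc j) = x))"
proof -
  let ?P = "\<lambda>x. take r (f x)" and ?S = "\<lambda>x. drop r (f x)"
  note nc = no_common_overhang[OF assms(1-3)]
  consider "?P a = ?P b" | "?S a = ?S b" | "?P a \<noteq> ?P b" "?S a \<noteq> ?S b" by blast
  then show ?thesis
  proof cases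
    case 1
    \<comment> \<open>Equal prefixes make each \<open>f (h' j)\<close> a rotation of
      \<open>f (h j)\<close> alone, so \<open>no_common_overhang\<close> forbids that both letters
      occur among the \<open>h j\<close>.\<close>
    then have P: "?P x = ?P y" for x y by (cases x; cases y) auto
    have "\<not> (h i = a \<and> h j = b)" if "1 \<le> i" "i < N" "1 \<le> j" "j < N" for i j
      using nc[of "h' i" "h' j"] rel[of i] rel[of j] that P by metis
    then have "(\<forall>j. 1 \<le> j \<and> j < N \<longrightarrow> h j \<noteq> b) \<or> (\<forall>j. 1 \<le> j \<and> j < N \<longrightarrow> h j \<noteq> a)"
      by blast
    then show ?thesis using letter_neq_iff by blast
  next
    case 2
    then have S: "?S x = ?S y" for x y by (cases x; cases y) auto
    have "\<not> (h (Suc i) = a \<and> h (Suc j) = b)" if "1 \<le> i" "i < N" "1 \<le> j" "j < N" for i j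
      using nc[of "h' i" "h' j"] rel[of i] rel[of j] that S by metis
    then have "(\<forall>j. 1 \<le> j \<and> j < N \<longrightarrow> h (Suc j) \<noteq> b) \<or> (\<forall>j. 1 \<le> j \<and> j < N \<longrightarrow> h (Suc j) \<noteq> a)"
      by blast
    then show ?thesis using letter_neq_iff by blast
  next
    case 3
    then have inj: "?P x = ?P y \<Longrightarrow> x = y" "?S x = ?S y \<Longrightarrow> x = y" for x y
      by (cases x; cases y; simp)+
    have inj2: "x = x' \<and> y = y'" if "?S x @ ?P y = ?S x' @ ?P y'" for x y x' y'
      using that inj by (simp add: append_eq_append_conv)
    show ?thesis
    proof (rule disjCI)
      assume "\<not> (\<exists>x. (\<forall>j. 1 \<le> j \<and> j < N \<longrightarrow> h j = x) \<or> (\<forall>j. 1 \<le> j \<and> j < N \<longrightarrow> h (Suc j) = x))"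
      then have n1: "\<And>x. \<exists>j. 1 \<le> j \<and> j < N \<and> h j \<noteq> x" and n2: "\<And>x. \<exists>j. 1 \<le> j \<and> j < N \<and> h (Suc j) \<noteq> x"
        by blast+
      show "\<forall>j. 1 \<le> j \<and> j < N \<longrightarrow> h j \<noteq> h (Suc j)"
      proof (rule ccontr)
        assume "\<not> (\<forall>j. 1 \<le> j \<and> j < N \<longrightarrow> h j \<noteq> h (Suc j))"
        then obtain i where i: "1 \<le> i" "i < N" "h (Suc i) = h i" by (simp add: eq_commute) (elim exE conjE)
        \<comment> \<open>The letter \<open>h' i\<close> belongs to the pair
          \<open>(h i, h i)\<close> only, and the other letter to one pair
          \<open>(h m, h (Suc m))\<close> only. If that pair is constant, so is \<open>h\<close>;
          otherwise it contains \<open>h i\<close>, and all first or all second components equal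
          \<open>h i\<close>. Both outcomes contradict \<open>n1\<close> or
          \<open>n2\<close>.\<close>
        have same: "h j = h i \<and> h (Suc j) = h i" if "1 \<le> j" "j < N" "h' j = h' i" for j
        proof -
          have "?S (h j) @ ?P (h (Suc j)) = ?S (h i) @ ?P (h i)"
            using rel[OF that(1,2)] rel[OF i(1,2)] that(3) i(3) by metis
          from inj2[OF this] show ?thesis .
        qed
        obtain m where m: "1 \<le> m" "m < N" "h' m \<noteq> h' i"
          using same n1[of "h i"] by blast
        have two: "h j = h m \<and> h (Suc j) = h (Suc m)" if "1 \<le> j" "j < N" "h' j \<noteq> h' i" for j
        proof -
          have "h' j = h' m" using that m by (cases "h' j"; cases "h' i"; cases "h' m") auto
          then have "?S (h j) @ ?P (h (Suc j)) = ?S (h m) @ ?P (h (Suc m))"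
            using rel[OF that(1,2)] rel[OF m(1,2)] by metis
          from inj2[OF this] show ?thesis .
        qed
        show False
        proof (cases "h m = h (Suc m)")
          case True
          then have step: "h j = h (Suc j)" if "1 \<le> j" "j < N" for j
            using same[OF that] two[OF that] True by (cases "h' j = h' i") simp_all
          have "j < N \<longrightarrow> h j = h 1" if "1 \<le> j" for j
            using that by (induction j rule: dec_induct) (use step in auto)
          then show False using n1[of "h 1"] by auto
        next
          case False
          then have "h m = h i \<or> h (Suc m) = h i"
            by (cases "h m"; cases "h i"; cases "h (Suc m)") auto
          moreover obtain j j' where "1 \<le> j" "j < N" "h j \<noteq> h i" "1 \<le> j'" "j' < N" "h (Suc j') \<noteq> h i"
            using n1[of "h i"] n2[of "h i"] by blast
          ultimately show False
            using same[of j] two[of j] same[of j'] two[of j'] by metis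
        qed
      qed
    qed
  qed
qed

text \<open>Write \<open>f a = p @ s\<close> and \<open>f b = p' @ s'\<close> with \<open>p\<close>,
  \<open>p'\<close> of length \<open>r\<close>. If \<open>c = a\<close>, then \<open>p\<close>
  commutes with \<open>f a @ f b\<close>; if \<open>c = b\<close>, then \<open>s'\<close>
  does.\<close>

lemma alternating_overlap:
  assumes "f a \<noteq> f b" "0 < r" "r < k"
    and "f c = drop r (f a) @ take r (f b)" "f d = drop r (f b) @ take r (f a)"
  obtains x y where "f a @ f b = x @ y" "x @ y = y @ x" "x \<noteq> []" "length x < k"
proof -
  define p s p' s' where ps: "p = take r (f a)" "s = drop r (f a)" "p' = take r (f b)" "s' = drop r (f b)"
  have f: "f a = p @ s" "f b = p' @ s'" by (simp_all add: ps)
  have l: "length p = r" "length p' = r" "length s = k - r" "length s' = k - r"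
    using assms(3) by (simp_all add: ps)
  have ne: "p \<noteq> []" "s' \<noteq> []" using l assms(2,3) by auto
  have fc: "f c = s @ p'" "f d = s' @ p" using assms(4,5) by (simp_all add: ps)
  have "s = s' \<and> p' = p" if "s @ p' = s' @ p"
    using that l append_eq_append_conv[of s s' p' p] by (simp only: simp_thms)
  then have "f c \<noteq> f d" using assms(1) unfolding f fc by blast
  then have "c \<noteq> d" by blast
  then consider "c = a" "d = b" | "c = b" "d = a" by (cases c; cases d) auto
  then show thesis
  proof cases
    case 1
    then have e: "s @ p' = p @ s" "s' @ p = p' @ s'" using f fc by metis+
    have "(s @ p' @ s') @ p = (s @ p') @ (s' @ p)" by simp
    also have "\<dots> = p @ s @ p' @ s'" unfolding e by simp
    finally have c: "p @ s @ p' @ s' = (s @ p' @ s') @ p" ..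
    have "f a @ f b = p @ s @ p' @ s'" by (simp add: f)
    from that[OF this c ne(1)] show thesis using l assms(3) by simp
  next
    case 2
    then have e: "s @ p' = p' @ s'" "s' @ p = p @ s" using f fc by metis+
    have c: "f a @ f b = s' @ p @ p' @ s'" using e(2) by (simp add: f)
    have "(p @ p' @ s') @ s' = p @ (s @ p') @ s'" unfolding e by simp
    also have "\<dots> = (s' @ p) @ p' @ s'" unfolding e(2) by simp
    finally have "s' @ p @ p' @ s' = (p @ p' @ s') @ s'" by simp
    from that[OF c this ne(2)] show thesis using l assms(2,3) by simp
  qed
qed

end

section \<open>Circular systems\<close>

locale circular_uniform = uniform_morphism +
  assumes circ: "circular f [a]"
begin

section \<open>Factors of the language\<close>

lemma SL_factor: "p @ u @ s \<in> SL f [a] \<Longrightarrow> u \<in> SL f [a]"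
  unfolding SL_def factors_def by clarsimp (metis append.assoc)

lemma SL_morph: "u \<in> SL f [a] \<Longrightarrow> morph f u \<in> SL f [a]"
proof -
  assume "u \<in> SL f [a]"
  then obtain n p s where "(morph f ^^ n) [a] = p @ u @ s" by (auto simp: SL_def factors_def lang_def)
  then have "(morph f ^^ Suc n) [a] = morph f p @ morph f u @ morph f s" by simp
  then show ?thesis unfolding SL_def factors_def lang_def by blast
qed

lemma SL_letter: "[c] \<in> SL f [a]"
  using circ by (simp add: circular_def PD0L_def minimal_alphabet_def)

lemma SL_interp:
  assumes "u \<in> SL f [a]" "2 \<le> length u"
  obtains v p s where "v \<in> SL f [a]" "morph f v = p @ u @ s"
proof -
  from assms obtain n p s where n: "(morph f ^^ n) [a] = p @ u @ s" by (auto simp: SL_def factors_def lang_def)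
  \<comment> \<open>The axiom is a single letter, so a factor of length at least two occurs in an
    image.\<close>
  have "n \<noteq> 0" using arg_cong[OF n, of length] assms(2) by (intro notI) simp
  then obtain m where "n = Suc m" by (cases n) auto
  then have "morph f ((morph f ^^ m) [a]) = p @ u @ s" using n by simp
  moreover have "(morph f ^^ m) [a] = [] @ (morph f ^^ m) [a] @ []" by simp
  then have "(morph f ^^ m) [a] \<in> SL f [a]"
    unfolding SL_def factors_def lang_def by blast
  ultimately show thesis by (rule that[rotated])
qed

lemma SL_run_interp:
  assumes "replicate m x \<in> SL f [a]" "2 \<le> m"
  obtains v p s where "v \<in> SL f [a]" "morph f v = p @ replicate m x @ s"
proof -
  have "2 \<le> length (replicate m x)" using assms(2) by simp
  from SL_interp[OF assms(1) this] show thesis using that .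
qed

lemma f_inj: "f x = f y \<longleftrightarrow> x = y"
proof
  assume "f x = f y"
  then have "morph f [x] = morph f [y]" by simp
  then show "x = y" using circ SL_letter unfolding circular_def injective_on_SL_def by blast
qed simp

lemma SL_run:
  assumes "v \<in> SL f [a]" "m + n \<le> length v" "\<And>j. m \<le> j \<Longrightarrow> j < m + n \<Longrightarrow> v ! j = x"
  shows "replicate n x \<in> SL f [a]"
proof -
  have "replicate n x = take n (drop m v)"
    using assms(2,3) by (intro nth_equalityI) auto
  moreover have "v = take m v @ take n (drop m v) @ drop n (drop m v)" by (metis append_take_drop_id)
  ultimately show ?thesis using SL_factor assms(1) by metis
qed

section \<open>Synchronization as agreement of block offsets\<close>

text \<open>A synchronizing point is a block boundary in both interpretations, so \<open>k\<close>
  divides \<open>length p + j\<close> and \<open>length p' + j\<close>.\<close>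

lemma sync_point_interps:
  assumes "sync_point f [a] u j" "v \<in> SL f [a]" "v' \<in> SL f [a]"
    "morph f v = p @ u @ s" "morph f v' = p' @ u @ s'"
  shows "length p mod k = length p' mod k"
proof -
  have "interp f [a] u (p, v, s)" "interp f [a] u (p', v', s')"
    using assms by (simp_all add: interp_def)
  then have "synchronized_at f u j (p, v, s) (p', v', s')" and j: "j \<le> length u"
    using assms(1) by (auto simp: sync_point_def)
  then obtain i i' where "morph f (take i v) = p @ take j u" "morph f (take i' v') = p' @ take j u"
    by (auto simp: synchronized_at_def)
  then have "k * length (take i v) = length p + j" "k * length (take i' v') = length p' + j"
    using j by (metis length_append length_morph length_take min.absorb2)+
  then have "(length p + j) mod k = (length p' + j) mod k" by (metis mod_mult_self1_is_0)
  then show ?thesis using cong_add_rcancel_nat[of "length p" j "length p'" k] by (simp add: cong_def)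
qed

lemma not_circular:
  assumes "\<And>n. \<exists>u v v' p p' s s'. n < length u \<and> v \<in> SL f [a] \<and> v' \<in> SL f [a]
    \<and> morph f v = p @ u @ s \<and> morph f v' = p' @ u @ s' \<and> length p mod k \<noteq> length p' mod k"
  shows False
proof -
  from circ obtain Z where Z: "sync_delay f [a] Z" by (auto simp: circular_def)
  from assms[of Z] obtain u v v' p p' s s' where *: "Z < length u" "v \<in> SL f [a]" "v' \<in> SL f [a]"
    "morph f v = p @ u @ s" "morph f v' = p' @ u @ s'" "length p mod k \<noteq> length p' mod k" by blast
  then have "u \<in> SL f [a]" using SL_morph SL_factor by metis
  then obtain j where "sync_point f [a] u j" using Z * by (auto simp: sync_delay_def)
  from sync_point_interps[OF this *(2-5)] *(6) show False by simp
qed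

text \<open>After trimming, the hypothesis says that all interpretations of a long \<open>u\<close>
  have the same offset modulo \<open>k\<close>. They then share their block boundaries, and the
  first one inside \<open>u\<close> is a synchronizing point.\<close>

lemma Z_min_le:
  assumes "k \<le> B"
    and "\<And>u v v' p p' s s'. \<lbrakk>B < length u; v \<in> SL f [a]; v' \<in> SL f [a]; morph f v = p @ u @ s;
      morph f v' = p' @ u @ s'; length p' < length p; length p < k\<rbrakk> \<Longrightarrow> False"
  shows "Z_min f [a] \<le> B"
proof -
  have eq: "length p' mod k = length p mod k"
    if u: "B < length u" and v: "v \<in> SL f [a]" "morph f v = p @ u @ s"
      and v': "v' \<in> SL f [a]" "morph f v' = p' @ u @ s'" for u v v' p p' s s'
  proof -
    obtain x w y q t where w: "v = x @ w @ y" "morph f w = q @ u @ t" "length q = length p mod k" "length t < k"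
      using trim[OF v(2)] .
    obtain x' w' y' q' t' where w': "v' = x' @ w' @ y'" "morph f w' = q' @ u @ t'" "length q' = length p' mod k" "length t' < k"
      using trim[OF v'(2)] .
    have SL: "w \<in> SL f [a]" "w' \<in> SL f [a]" using v v' w w' SL_factor by metis+
    have "length q < k" "length q' < k" using w w' k2 by simp_all
    then show ?thesis
      using assms(2)[OF u SL w(2) w'(2)] assms(2)[OF u SL(2,1) w'(2) w(2)] w(3) w'(3)
      by (metis nat_neq_iff)
  qed
  have "\<exists>j. sync_point f [a] u j" if u: "B < length u" for u
  proof -
    \<comment> \<open>The offset common to all interpretations, or 0 if there are none; the first
      block boundary in \<open>u\<close> is then at \<open>(k - \<rho>) mod k\<close>.\<close>
    obtain \<rho> where \<rho>: "\<rho> < k" "\<And>v p s. v \<in> SL f [a] \<Longrightarrow> morph f v = p @ u @ s \<Longrightarrow> length p mod k = \<rho>"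
    proof (cases "\<exists>v p s. v \<in> SL f [a] \<and> morph f v = p @ u @ s")
      case True
      then obtain v p s where "v \<in> SL f [a]" "morph f v = p @ u @ s" by blast
      have "length p' mod k = length p mod k"
        if "v' \<in> SL f [a]" "morph f v' = p' @ u @ s'" for v' p' s'
        by (rule eq[OF u \<open>v \<in> SL f [a]\<close> \<open>morph f v = p @ u @ s\<close> that])
      then show thesis using that[of "length p mod k"] k2 by simp
    qed (use that[of 0] k2 in auto)
    define j where "j = (k - \<rho>) mod k"
    have j: "j < k" using k2 by (simp add: j_def)
    have cut: "\<exists>i \<le> length v. morph f (take i v) = p @ take j u"
      if v: "v \<in> SL f [a]" "morph f v = p @ u @ s" for v p s
    proof -
      have "(length p + j) mod k = (\<rho> + (k - \<rho>)) mod k"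
        using \<rho>(2)[OF v] unfolding j_def by (metis mod_add_eq mod_mod_trivial)
      then have "k dvd length p + j" using \<rho>(1) by auto
      then obtain i where i: "length p + j = k * i" ..
      have ju: "j \<le> length u" using j u assms(1) by simp
      have "k * length v = length p + length u + length s"
        using arg_cong[OF v(2), of length] by simp
      then have "k * i \<le> k * length v" using i ju by linarith
      then have "i \<le> length v" using k2 by simp
      moreover have "morph f (take i v) = p @ take j u"
        by (simp add: take_morph[symmetric] v(2) i[symmetric] ju)
      ultimately show ?thesis by blast
    qed
    have "sync_point f [a] u j"
      unfolding sync_point_def
    proof (intro conjI allI impI)
      show "j \<le> length u" using j u assms(1) by simp
      fix I I' assume I: "interp f [a] u I" "interp f [a] u I'"
      obtain p v s p' v' s' where eqs: "I = (p, v, s)" "I' = (p', v', s')"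
        by (cases I; cases I')
      have "\<exists>i\<le>length v. morph f (take i v) = p @ take j u"
        using I(1) by (intro cut[of v p s]) (simp_all add: eqs interp_def)
      moreover have "\<exists>i\<le>length v'. morph f (take i v') = p' @ take j u"
        using I(2) by (intro cut[of v' p' s']) (simp_all add: eqs interp_def)
      ultimately show "synchronized_at f u j I I'"
        unfolding eqs synchronized_at_def prod.case by blast
    qed
    then show ?thesis ..
  qed
  then have "sync_delay f [a] B" using assms(1) k2 by (auto simp: sync_delay_def)
  then show ?thesis unfolding Z_min_def by (rule Least_le)
qed

section \<open>Patterns excluded by circularity\<close>

text \<open>By induction on \<open>n\<close>, every \<open>replicate (k ^ n) z\<close> with
  \<open>z\<close> in \<open>S\<close> is a factor. So arbitrarily long runs are images of runs, and
  these can be read at two offsets.\<close>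

lemma no_letter_powers:
  assumes "x \<in> S" "\<And>z. z \<in> S \<Longrightarrow> \<exists>z'\<in>S. f z' = replicate k z"
  shows False
proof (rule not_circular)
  have pw: "replicate (k ^ n) z \<in> SL f [a]" if "z \<in> S" for n z
    using that
  proof (induction n arbitrary: z)
    case 0
    then show ?case using SL_letter by simp
  next
    case (Suc n)
    then obtain z' where "z' \<in> S" "f z' = replicate k z" using assms(2) by blast
    then show ?case using SL_morph[OF Suc.IH[of z']] by (simp add: morph_replicate[of z' z])
  qed
  fix n
  obtain z where z: "z \<in> S" "f z = replicate k x" using assms by blast
  \<comment> \<open>\<open>?u\<close> is one letter shorter than the image of \<open>?v\<close>, so
    it occurs there at offset 0 and at offset 1.\<close>
  let ?v = "replicate (k ^ Suc n) z" and ?u = "replicate (k * k ^ Suc n - 1) x"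
  have big: "Suc n < k ^ Suc n" using less_exp[of "Suc n"] power_mono[OF k2, of "Suc n"] by linarith
  have m: "morph f ?v = replicate (k * k ^ Suc n) x" using z(2) by (rule morph_replicate)
  have p: "0 < k * k ^ Suc n" using k2 by simp
  have "k ^ Suc n \<le> k * k ^ Suc n" using k2 by simp
  then have "n < length ?u" using big by (simp only: length_replicate)
  moreover have "morph f ?v = [] @ ?u @ [x]" "morph f ?v = [x] @ ?u @ []"
    using p unfolding m by (cases "k * k ^ Suc n"; simp add: replicate_append_same)+
  moreover have "length [] mod k \<noteq> length [x] mod k" using k2 by simp
  moreover have "?v \<in> SL f [a]" using pw z(1) by blast
  ultimately show "\<exists>u v v' p p' s s'. n < length u \<and> v \<in> SL f [a] \<and> v' \<in> SL f [a]
    \<and> morph f v = p @ u @ s \<and> morph f v' = p' @ u @ s' \<and> length p mod k \<noteq> length p' mod k"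
    by blast
qed

lemma not_own_power: "f x \<noteq> replicate k x"
  using no_letter_powers[of x "{x}"] by blast

lemma not_swapped_powers: "x \<noteq> y \<Longrightarrow> f x = replicate k y \<Longrightarrow> f y \<noteq> replicate k x"
  using no_letter_powers[of x "{x, y}"] by blast

text \<open>If \<open>f a @ f b\<close> alternates, the images alternate and differ in their first
  and in their last letters. Hence \<open>f\<close> preserves alternation, alternating factors get
  arbitrarily long, and their images can be read at two offsets.\<close>

lemma no_alternating_images: "\<not> distinct_adj (f a @ f b)"
proof
  assume "distinct_adj (f a @ f b)"
  moreover have ne: "f c \<noteq> []" for c using len[of c] k2 by (metis list.size(3) not_numeral_le_zero)
  ultimately have ab: "distinct_adj (f a)" "distinct_adj (f b)" "last (f a) \<noteq> hd (f b)"
    by (auto simp: distinct_adj_append_iff)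
  then have alt: "distinct_adj (f c)" for c by (cases c) auto
  have nab: "f a \<noteq> f b" by (simp add: f_inj)
  have hd: "hd (f a) \<noteq> hd (f b)"
    using distinct_adj_letter_unique[OF ab(1,2)] nab by auto
  have "rev (f a) \<noteq> rev (f b)" using nab by simp
  then have "hd (rev (f a)) \<noteq> hd (rev (f b))"
    using distinct_adj_letter_unique[of "rev (f a)" "rev (f b)"] ab by auto
  then have last: "last (f a) \<noteq> last (f b)" by (simp add: hd_rev)
  have "last (f b) \<noteq> hd (f a)"
    using hd last ab(3) by (cases "hd (f a)"; cases "hd (f b)"; cases "last (f a)"; cases "last (f b)") auto
  then have junction: "last (f c) \<noteq> hd (f d)" if "c \<noteq> d" for c d
    using that ab(3) by (cases c; cases d) auto
  have morph_alt: "distinct_adj (morph f v)" if "distinct_adj v" for v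
    using that
  proof (induction v)
    case (Cons c v)
    then show ?case using ne alt junction
      by (cases v) (auto simp: distinct_adj_append_iff)
  qed simp
  have pw: "\<exists>w \<in> SL f [a]. distinct_adj w \<and> length w = k ^ n" for n
  proof (induction n)
    case 0
    then show ?case using SL_letter[of a] by force
  next
    case (Suc n)
    then obtain w where "w \<in> SL f [a]" "distinct_adj w" "length w = k ^ n" by blast
    then show ?case using SL_morph morph_alt by (intro bexI[of _ "morph f w"]) auto
  qed
  show False
  proof (rule not_circular)
    fix n
    obtain w where w: "w \<in> SL f [a]" "distinct_adj w" "length w = k ^ Suc (Suc n)" using pw by blast
    have big: "Suc (Suc n) < length w"
      using less_exp[of "Suc (Suc n)"] power_mono[OF k2, of "Suc (Suc n)"] unfolding w(3) by linarith
    then obtain c d t where wt: "w = c # d # t"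
      by (cases w; cases "tl w") auto
    \<comment> \<open>Without its first letter, the image of \<open>d # t\<close> starts with the
      first letter of \<open>f c\<close>; as both words alternate, it is a prefix of the image of
      \<open>w\<close>.\<close>
    let ?v = "d # t" and ?u = "tl (morph f (d # t))"
    obtain x1 x2 z where fd: "f d = x1 # x2 # z" using len[of d] k2 by (cases "f d"; cases "tl (f d)") auto
    have v': "?v \<in> SL f [a]" using w(1) SL_factor[of "[c]" ?v "[]"] by (simp add: wt)
    have mv: "morph f ?v = [x1] @ ?u @ []" by (simp add: fd)
    have "distinct_adj (morph f ?v)" by (rule morph_alt) (use w(2) wt in simp)
    then have uadj: "distinct_adj ?u" and x12: "x1 \<noteq> x2" by (auto simp: fd)
    have "c \<noteq> d" using w(2) by (simp add: wt)
    then have "hd (f c) \<noteq> x1" using hd fd by (cases c; cases d) auto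
    then have hdc: "hd (f c) = x2" using x12 by (cases "hd (f c)"; cases x1; cases x2) auto
    have "?u = take (length ?u) (morph f w)"
    proof (rule distinct_adj_letter_unique[OF uadj])
      show "distinct_adj (take (length ?u) (morph f w))"
        using morph_alt[OF w(2)] distinct_adj_prefix[of "take (length ?u) (morph f w)" "drop (length ?u) (morph f w)"]
        by simp
      show "hd ?u = hd (take (length ?u) (morph f w))"
        using hdc ne[of c] by (simp add: fd wt)
    qed (simp add: wt)
    then have mw: "morph f w = [] @ ?u @ drop (length ?u) (morph f w)"
      by (metis append_Nil append_take_drop_id)
    have "2 * length ?v \<le> k * length ?v" using k2 by (rule mult_le_mono1)
    then have n: "n < length ?u" using big by (simp add: wt)
    have ne_mod: "length [] mod k \<noteq> length [x1] mod k" using k2 by simp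
    show "\<exists>u v v' p p' s s'. n < length u \<and> v \<in> SL f [a] \<and> v' \<in> SL f [a]
      \<and> morph f v = p @ u @ s \<and> morph f v' = p' @ u @ s' \<and> length p mod k \<noteq> length p' mod k"
      by (intro exI conjI) (fact n, fact w(1), fact v', fact mw, fact mv, fact ne_mod)
  qed
qed

text \<open>Here \<open>f a @ f b\<close> is a power of a word of length \<open>l < k\<close>, and
  \<open>l dvd k\<close> would give \<open>f a = f b\<close>. For prime \<open>k\<close> this leaves
  \<open>l = 2\<close>; otherwise the alternating block \<open>f c\<close> is longer than the period
  \<open>l\<close> and passes its alternation on. Both cases contradict
  \<open>no_alternating_images\<close>.\<close>

lemma no_commuting_factorization:
  assumes "f a @ f b = x @ y" "x @ y = y @ x" "x \<noteq> []" "length x < k"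
    and "prime k \<or> distinct_adj (f c)"
  shows False
proof -
  obtain w m n where w: "w \<noteq> []" "x = concat (replicate m w)" "x @ y = concat (replicate n w)"
    using comm_root[OF assms(2,3)] .
  define l where "l = length w"
  have "l > 0" using w(1) by (simp add: l_def)
  have "length x = m * l" using w(2) by (simp add: l_def length_concat_replicate)
  then have "l \<le> length x" using assms(3) by (cases m) auto
  then have lk: "l < k" using assms(4) by simp
  have "length (f a @ f b) = n * l" unfolding assms(1) w(3) l_def by (rule length_concat_replicate)
  then have nl: "2 * k = n * l" by simp
  have per: "(f a @ f b) ! i = w ! (i mod l)" if "i < 2 * k" for i
    using that nl unfolding assms(1) w(3) l_def by (intro nth_concat_replicate) simp
  have ndvd: "\<not> l dvd k"
  proof
    assume "l dvd k"
    have "f a = f b"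
    proof (rule nth_equalityI)
      fix i assume "i < length (f a)"
      then have i: "i < k" by simp
      have "f a ! i = w ! (i mod l)" using per[of i] i by (simp add: nth_append)
      moreover have "f b ! i = w ! ((k + i) mod l)" using per[of "k + i"] i by (simp add: nth_append)
      moreover have "(k + i) mod l = i mod l" using \<open>l dvd k\<close> by (auto elim!: dvdE)
      ultimately show "f a ! i = f b ! i" by simp
    qed simp
    then show False by (simp add: f_inj)
  qed
  have "distinct_adj (f a @ f b)"
    using assms(5)
  proof
    assume "prime k"
    have "coprime k l" using \<open>prime k\<close> lk \<open>l > 0\<close> by (auto intro!: prime_imp_coprime dest: dvd_imp_le)
    moreover have "l dvd 2 * k" using nl by simp
    ultimately have "l dvd 2" using coprime_commute coprime_dvd_mult_left_iff by blast
    moreover have "l \<noteq> 1" using ndvd by auto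
    ultimately have l2: "l = 2" using \<open>l > 0\<close> dvd_imp_le[of l 2] by (cases "l = 0 \<or> l = 1 \<or> l = 2") auto
    have "w ! 0 \<noteq> w ! 1"
    proof
      assume "w ! 0 = w ! 1"
      then have p0: "(f a @ f b) ! i = w ! 0" if "i < 2 * k" for i
        using per[OF that] by (cases "even i") (auto simp: l2 odd_iff_mod_2_eq_one)
      have "f a = f b"
      proof (rule nth_equalityI)
        fix i assume i: "i < length (f a)"
        then show "f a ! i = f b ! i" using p0[of i] p0[of "k + i"] by (simp add: nth_append)
      qed simp
      then show False by (simp add: f_inj)
    qed
    then show ?thesis unfolding distinct_adj_nth
      using per by (auto simp: l2 mod_Suc)
  next
    assume alt: "distinct_adj (f c)"
    define e where "e = (if c = a then 0 else k)"
    have fc: "f c ! i = w ! ((e + i) mod l)" if "i < k" for i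
      using per[of "e + i"] that by (cases c) (auto simp: e_def nth_append)
    show ?thesis unfolding distinct_adj_nth
    proof (intro allI impI)
      fix i assume i: "Suc i < length (f a @ f b)"
      \<comment> \<open>\<open>e * (l - 1)\<close> acts as the negative of \<open>e\<close> modulo
        \<open>l\<close>, so position \<open>j\<close> of \<open>f c\<close> has the residue of
        \<open>i\<close>; \<open>l < k\<close> keeps \<open>Suc j\<close> inside the block.\<close>
      define j where "j = (i + e * (l - 1)) mod l"
      have "e + (i + e * (l - 1)) = i + e * l" using \<open>l > 0\<close> by (cases l) auto
      then have j: "(e + j) mod l = i mod l" unfolding j_def by (metis mod_add_right_eq mod_mult_self1)
      then have j': "(e + Suc j) mod l = Suc i mod l" by (metis add_Suc_right mod_Suc_eq)
      have "Suc j < k" using lk \<open>l > 0\<close> mod_less_divisor[of l] unfolding j_def by (metis Suc_leI le_less_trans)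
      then have "f c ! j \<noteq> f c ! Suc j" using alt by (simp add: distinct_adj_nth)
      then show "(f a @ f b) ! i \<noteq> (f a @ f b) ! Suc i"
        using fc[of j] fc[of "Suc j"] \<open>Suc j < k\<close> j j' per[of i] per[of "Suc i"] i by simp
    qed
  qed
  then show False using no_alternating_images by blast
qed

section \<open>The two kinds of unsynchronized words\<close>

text \<open>\<open>overlap\<close> describes the blocks 1 to \<open>n - 1\<close> of
  \<open>v'\<close>, and \<open>overlap_structure\<close> applies. In its constant cases
  \<open>n - 1\<close> entries of \<open>v\<close> agree; a block of \<open>v'\<close> is a rotation
  of \<open>f x\<close> when two neighbouring entries are \<open>x\<close>, which leaves
  \<open>n - 2\<close> entries of \<open>v'\<close>.\<close>

lemma unsynchronized_cases:
  assumes v: "v \<in> SL f [a]" "morph f v = p @ u @ s" and v': "v' \<in> SL f [a]" "morph f v' = p' @ u @ s'"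
    and p: "length p' < length p" "length p < k" and n: "k * n \<le> length u" "3 \<le> n"
  obtains (alternating) w x y where "w \<in> SL f [a]" "distinct_adj w" "length w = n"
      "f a @ f b = x @ y" "x @ y = y @ x" "x \<noteq> []" "length x < k"
    | (letter_powers) x y r where "0 < r" "r < k" "f y = drop r (f x) @ take r (f x)"
      "replicate (n - 1) x \<in> SL f [a]" "replicate (n - 2) y \<in> SL f [a]"
proof -
  define r where "r = length p - length p'"
  have r: "0 < r" "r < k" using p by (auto simp: r_def)
  have nab: "f a \<noteq> f b" by (simp add: f_inj)
  have kj: "k * Suc j \<le> length u" if "j < n" for j
    using mult_le_mono2[of "Suc j" n k] that n by linarith
  have rel: "f (v' ! j) = drop r (f (v ! j)) @ take r (f (v ! Suc j))" if "1 \<le> j" "j < n" for j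
    using overlap(3)[OF v(2) v'(2) p _ kj] that by (simp add: r_def)
  have l: "n < length v" "n - 1 < length v'"
    using overlap(1,2)[OF v(2) v'(2) p _ kj, of "n - 1"] n by simp_all
  from overlap_structure[where h = "\<lambda>j. v ! j" and h' = "\<lambda>j. v' ! j", OF nab r rel] consider
      "\<forall>j. 1 \<le> j \<and> j < n \<longrightarrow> v ! j \<noteq> v ! Suc j"
    | x where "\<forall>j. 1 \<le> j \<and> j < n \<longrightarrow> v ! j = x"
    | x where "\<forall>j. 1 \<le> j \<and> j < n \<longrightarrow> v ! Suc j = x" by blast
  then show thesis
  proof cases
    case 1
    let ?w = "take n (drop 1 v)"
    have "v = take 1 v @ ?w @ drop n (drop 1 v)" by (metis append_take_drop_id)
    then have w: "?w \<in> SL f [a]" using v(1) SL_factor by metis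
    have wl: "length ?w = n" using l n by simp
    have "?w ! i = v ! Suc i" if "i < n" for i using that l by simp
    then have wadj: "distinct_adj ?w" unfolding distinct_adj_nth wl using 1 by auto
    \<comment> \<open>Three consecutive entries of \<open>v\<close> provide both mixed overlaps,
      \<open>a\<close> before \<open>b\<close> and \<open>b\<close> before \<open>a\<close>, as
      \<open>alternating_overlap\<close> requires.\<close>
    have v123: "v ! 1 \<noteq> v ! 2" "v ! 2 \<noteq> v ! 3"
      using 1[rule_format, of 1] 1[rule_format, of 2] n by (simp_all add: numeral_2_eq_2 numeral_3_eq_3)
    have f12: "f (v' ! 1) = drop r (f (v ! 1)) @ take r (f (v ! 2))"
      "f (v' ! 2) = drop r (f (v ! 2)) @ take r (f (v ! 3))"
      using rel[of 1] rel[of 2] n by (simp_all add: numeral_2_eq_2 numeral_3_eq_3)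
    obtain c d where cd: "f c = drop r (f a) @ take r (f b)" "f d = drop r (f b) @ take r (f a)"
    proof (cases "v ! 1")
      case a
      then have v2: "v ! 2 = b" using v123(1) letter_neq_iff(1)[of "v ! 2"] by simp
      then have v3: "v ! 3 = a" using v123(2) letter_neq_iff(2)[of "v ! 3"] by simp
      show thesis using that[of "v' ! 1" "v' ! 2"] f12 by (simp only: a v2 v3)
    next
      case b
      then have v2: "v ! 2 = a" using v123(1) letter_neq_iff(2)[of "v ! 2"] by simp
      then have v3: "v ! 3 = b" using v123(2) letter_neq_iff(1)[of "v ! 3"] by simp
      show thesis using that[of "v' ! 2" "v' ! 1"] f12 by (simp only: b v2 v3)
    qed
    show thesis
      using alternating_overlap[OF nab r cd] alternating[OF w wadj wl] by blast
  next
    case 2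
    have y: "f (v' ! j) = drop r (f x) @ take r (f x)" if "1 \<le> j" "j < n - 1" for j
      using rel[of j] 2 that by simp
    have y1: "f (v' ! 1) = drop r (f x) @ take r (f x)" using y[of 1] n by simp
    have y2: "v' ! j = v' ! 1" if "1 \<le> j" "j < n - 1" for j
      using trans[OF y[OF that] y1[symmetric]] by (simp only: f_inj)
    show thesis
    proof (rule letter_powers[OF r y1])
      show "replicate (n - 1) x \<in> SL f [a]" using 2 l n by (intro SL_run[OF v(1), of 1]) auto
      show "replicate (n - 2) (v' ! 1) \<in> SL f [a]"
        by (rule SL_run[OF v'(1), of 1]; (rule y2)?) (use l n in simp_all)
    qed
  next
    case 3
    have *: "v ! j = x" if "2 \<le> j" "j \<le> n" for j
    proof -
      have "1 \<le> j - 1 \<and> j - 1 < n" "Suc (j - 1) = j" using that by auto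
      then show ?thesis using 3[rule_format, of "j - 1"] by simp
    qed
    have y: "f (v' ! j) = drop r (f x) @ take r (f x)" if "2 \<le> j" "j < n" for j
      using rel[of j] *[of j] *[of "Suc j"] that by simp
    have y1: "f (v' ! 2) = drop r (f x) @ take r (f x)" using y[of 2] n by simp
    have y2: "v' ! j = v' ! 2" if "2 \<le> j" "j < n" for j
      using trans[OF y[OF that] y1[symmetric]] by (simp only: f_inj)
    show thesis
    proof (rule letter_powers[OF r y1])
      show "replicate (n - 1) x \<in> SL f [a]" using * l n by (intro SL_run[OF v(1), of 2]) auto
      show "replicate (n - 2) (v' ! 2) \<in> SL f [a]"
        by (rule SL_run[OF v'(1), of 2]; (rule y2)?) (use l n in simp_all)
    qed
  qed
qed

section \<open>Bounds on runs of a letter\<close>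

lemma eq_replicate_iff: "f c = replicate k z \<longleftrightarrow> set (f c) \<subseteq> {z}"
proof
  assume "set (f c) \<subseteq> {z}"
  then have "replicate (length (f c)) z = f c" by (intro replicate_length_same) blast
  then show "f c = replicate k z" by simp
qed (simp add: set_replicate_conv_if)

text \<open>Rotation preserves letter counts, so the two images have equal counts, and neither is a
  letter power since they would then coincide. \<open>run_bound_mixed\<close> bounds each run by
  twice the count of its letter, and the two counts add up to \<open>k\<close>.\<close>

lemma rotated_images_bound:
  assumes "x \<noteq> y" "f y = drop r (f x) @ take r (f x)"
    and "replicate m x \<in> SL f [a]" "2 \<le> m" "replicate n y \<in> SL f [a]" "2 \<le> n"
  shows "m + n \<le> 2 * k"
proof -
  have "set (f y) = set (take r (f x) @ drop r (f x))" unfolding assms(2) set_append by (rule Un_commute)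
  then have "set (f y) = set (f x)" by simp
  then have sets: "set (f c) = set (f x)" for c using assms(1) by (cases c; cases x; cases y) auto
  have mixed: "f c \<noteq> replicate k z" for c z
  proof
    assume "f c = replicate k z"
    then have "set (f x) \<subseteq> {z}" using eq_replicate_iff sets by blast
    then have "f x = replicate k z" "f y = replicate k z" using eq_replicate_iff sets by blast+
    then have "f x = f y" by (rule trans[OF _ sym])
    then show False using assms(1) by (simp add: f_inj)
  qed
  have "count_list (f y) z = count_list (take r (f x) @ drop r (f x)) z" for z
    unfolding assms(2) count_list_append by (rule add.commute)
  then have "count_list (f y) z = count_list (f x) z" for z by simp
  then have counts: "count_list (f c) z = count_list (f x) z" for c z
    using assms(1) by (cases c; cases x; cases y) auto
  have total: "count_list w a + count_list w b = length w" for w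
  proof (induction w)
    case (Cons c w)
    then show ?case by (cases c) auto
  qed simp
  obtain v p s where "v \<in> SL f [a]" and "morph f v = p @ replicate m x @ s" using SL_run_interp[OF assms(3,4)] .
  then have "m \<le> 2 * count_list (f x) x" using run_bound_mixed mixed counts by blast
  moreover obtain v p s where "v \<in> SL f [a]" and "morph f v = p @ replicate n y @ s" using SL_run_interp[OF assms(5,6)] .
  then have "n \<le> 2 * count_list (f x) y" using run_bound_mixed mixed counts by blast
  moreover have "count_list (f x) x + count_list (f x) y = k"
    using total[of "f x"] assms(1) by (cases x; cases y) auto
  ultimately show ?thesis by linarith
qed

text \<open>Circularity excludes \<open>z = x\<close> and \<open>f z = replicate k x\<close>, so
  \<open>f z\<close> has a \<open>z\<close> at some position \<open>i\<close>. So does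
  \<open>f x\<close>, hence every block interrupts runs of \<open>x\<close> at position
  \<open>i\<close>.\<close>

lemma letter_power_run_bound:
  assumes "f x = replicate k z" "replicate m x \<in> SL f [a]" "2 \<le> m"
  shows "m < k"
proof -
  have zx: "z \<noteq> x" using assms(1) not_own_power[of x] by auto
  have "f z \<noteq> replicate k x" using not_swapped_powers[OF zx[symmetric] assms(1)] .
  then have "\<not> set (f z) \<subseteq> {x}" using eq_replicate_iff by blast
  then obtain e where "e \<in> set (f z)" "e \<noteq> x" by blast
  moreover have "e = z" using letter_neq_unique[OF \<open>e \<noteq> x\<close> zx] .
  ultimately have "z \<in> set (f z)" by simp
  then obtain i where i: "i < k" "f z ! i = z" by (auto simp: in_set_conv_nth)
  have fi: "f c ! i = z" for c
    using i assms(1) zx by (cases c; cases x; cases z) auto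
  obtain v p s where "v \<in> SL f [a]" and v: "morph f v = p @ replicate m x @ s"
    using SL_run_interp[OF assms(2,3)] .
  have "m + card {i} \<le> k"
  proof (rule run_avoids_residues[OF v])
    show "morph f v ! j \<noteq> x" if "j < length (morph f v)" "j mod k \<in> {i}" for j
      using nth_morph'[OF that(1)] that(2) fi zx by simp
  qed (use i in auto)
  then show ?thesis by simp
qed

text \<open>Let \<open>X\<close> and \<open>Y\<close> be the positions of \<open>x\<close> and
  \<open>y\<close> in \<open>w\<close>. A run of \<open>x\<close> longer than a block consists of
  the image of a run of \<open>y\<close>, possibly extended at its ends into images of
  \<open>x\<close>. The run of \<open>y\<close> has at most \<open>card Y\<close> letters and the
  extensions at most \<open>card X\<close> in total.\<close>

lemma mixed_root_run_bound:
  assumes fy: "f y = replicate k x" and xy: "x \<noteq> y"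
    and w: "f x = concat (replicate n w)" "x \<in> set w" "y \<in> set w"
    and m: "replicate m x \<in> SL f [a]" "2 \<le> m"
  shows "m \<le> k * (length w - 1) + 1"
proof -
  define l where "l = length w"
  define X where "X = {i. i < l \<and> w ! i = x}"
  define Y where "Y = {i. i < l \<and> w ! i = y}"
  have "w ! i = y \<longleftrightarrow> w ! i \<noteq> x" for i using xy by (cases "w ! i"; cases x; cases y) auto
  then have "X \<union> Y = {..<l}" "X \<inter> Y = {}" by (auto simp: X_def Y_def)
  moreover have fin: "finite X" "finite Y" by (simp_all add: X_def Y_def)
  ultimately have XY: "card X + card Y = l" using card_Un_disjoint[of X Y] by simp
  have ne: "X \<noteq> {}" "Y \<noteq> {}" using w(2,3) by (auto simp: X_def Y_def l_def in_set_conv_nth)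
  then have pos: "1 \<le> card X" "1 \<le> card Y" using fin by (simp_all add: Suc_le_eq card_gt_0_iff)
  have k: "k = n * l" using arg_cong[OF w(1), of length] by (simp add: length_concat_replicate l_def)
  have fx: "f x ! i = w ! (i mod l)" if "i < k" for i
    using that unfolding w(1) l_def by (intro nth_concat_replicate) (simp add: k l_def)
  \<comment> \<open>Both images carry \<open>x\<close> at positions with residue in \<open>X\<close>
    modulo \<open>l\<close>, and \<open>l\<close> divides \<open>k\<close>.\<close>
  have y_run: "t \<le> card Y" if t: "replicate t y \<in> SL f [a]" for t
  proof (cases "2 \<le> t")
    case True
    obtain v p s where "v \<in> SL f [a]" and v: "morph f v = p @ replicate t y @ s"
      using SL_run_interp[OF t True] .
    have "t + card X \<le> l"
    proof (rule run_avoids_residues[OF v])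
      show "morph f v ! i \<noteq> y" if i: "i < length (morph f v)" "i mod l \<in> X" for i
      proof (cases "v ! (i div k) = x")
        case True
        have ik: "i mod k < k" using k2 by simp
        have "i mod k mod l = i mod l" by (simp add: k mod_mod_cancel)
        then have "morph f v ! i = w ! (i mod l)"
          using nth_morph'[OF i(1)] fx[OF ik] by (simp add: True)
        then show ?thesis using i(2) xy by (simp add: X_def)
      next
        case False
        then have "v ! (i div k) = y" by (rule letter_neq_unique) (rule xy[symmetric])
        then show ?thesis using nth_morph'[OF i(1)] k2 xy by (simp add: fy)
      qed
    qed (use ne in \<open>auto simp: X_def\<close>)
    then show ?thesis using XY by linarith
  qed (use pos in linarith)
  have x_run: "t \<le> card X" if "f x @ f x = p @ replicate t x @ s" for t p s
  proof -
    have ww: "f x @ f x = concat (replicate (n + n) w)" by (simp add: w(1) replicate_add)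
    have "t + card Y \<le> l"
    proof (rule run_avoids_residues[OF that])
      show "(f x @ f x) ! i \<noteq> x" if i: "i < length (f x @ f x)" "i mod l \<in> Y" for i
      proof -
        have "i < (n + n) * length w" using i(1) by (simp add: k l_def distrib_right)
        then have "(f x @ f x) ! i = w ! (i mod l)" unfolding ww l_def by (rule nth_concat_replicate)
        then show ?thesis using i(2) xy by (simp add: Y_def)
      qed
    qed (use ne in \<open>auto simp: Y_def\<close>)
    then show ?thesis using XY by linarith
  qed
  obtain v p s where v: "v \<in> SL f [a]" "morph f v = p @ replicate m x @ s"
    using SL_run_interp[OF m] .
  obtain v1 v2 v3 p' s' where v2: "v = v1 @ v2 @ v3" "morph f v2 = p' @ replicate m x @ s'"
    "length p' = length p mod k" "length s' < k" using trim[OF v(2)] .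
  have p': "length p' < k" using v2(3) k2 by simp
  have v2SL: "v2 \<in> SL f [a]" using SL_factor v(1) v2(1) by metis
  have lv: "k * length v2 = length p' + m + length s'"
    using arg_cong[OF v2(2), of length] by simp
  have "m \<le> card X + k * card Y"
  proof (cases "length v2 \<le> 1")
    case True
    then have "k * length v2 \<le> k * card Y" using pos by (intro mult_le_mono2) linarith
    then show ?thesis using lv by linarith
  next
    case False
    then obtain c r where cr: "v2 = c # r" "r \<noteq> []" by (cases v2) auto
    define u where "u = butlast r"
    define d where "d = last r"
    have v2e: "v2 = c # u @ [d]" using cr by (simp add: u_def d_def)
    \<comment> \<open>\<open>e1\<close> and \<open>e2\<close> count the letters of the run inside
      the first block \<open>f c\<close> and the last block \<open>f d\<close>.\<close>
    define e1 where "e1 = k - length p'"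
    define e2 where "e2 = k - length s'"
    have me: "m = e1 + k * length u + e2"
      using lv p' v2(4) by (simp add: v2e e1_def e2_def algebra_simps)
    have "drop (length p') (morph f v2) = replicate m x @ s'" by (simp add: v2(2))
    then have "take m (drop (length p') (f c @ morph f u @ f d)) = replicate m x" by (simp add: v2e)
    then have eq: "drop (length p') (f c) @ morph f u @ take e2 (f d) = replicate m x"
      using p' me by (simp add: e1_def)
    have sets: "set (drop (length p') (f c)) \<subseteq> {x}" "set (morph f u) \<subseteq> {x}" "set (take e2 (f d)) \<subseteq> {x}"
      using arg_cong[OF eq, of set] by (auto simp: set_replicate_conv_if split: if_splits)
    have rep: "z = replicate (length z) x" if "set z \<subseteq> {x}" for z
      using that by (intro replicate_length_same[symmetric]) blast
    have ends: "drop (length p') (f c) = replicate e1 x" "take e2 (f d) = replicate e2 x"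
      using rep[OF sets(1)] rep[OF sets(3)] by (simp_all add: e1_def e2_def)
    have fc: "f c = take (length p') (f c) @ replicate e1 x" by (simp flip: ends(1))
    have fd: "f d = replicate e2 x @ drop e2 (f d)" by (simp flip: ends(2))
    have "n \<noteq> 0" using k k2 by (cases n) auto
    then have yfx: "y \<in> set (f x)" using w(1,3) by simp
    have "z = y" if "z \<in> set u" for z
    proof -
      have "set (f z) \<subseteq> {x}" using sets(2) that by (auto simp: morph_def)
      then have "z \<noteq> x" using yfx xy by auto
      then show ?thesis by (rule letter_neq_unique) (rule xy[symmetric])
    qed
    then have u: "u = replicate (length u) y" by (intro replicate_length_same[symmetric]) blast
    have yrun: "length z \<le> card Y" if "v2 = z1 @ z @ z2" "set z \<subseteq> {y}" for z1 z z2
    proof -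
      have "z = replicate (length z) y" using that(2) by (intro replicate_length_same[symmetric]) blast
      then show ?thesis using y_run[of "length z"] SL_factor[of z1 z z2] v2SL that(1) by simp
    qed
    have setu: "set u \<subseteq> {y}" using \<open>\<And>z. z \<in> set u \<Longrightarrow> z = y\<close> by blast
    have ek: "e1 \<le> k" "e2 \<le> k" by (simp_all add: e1_def e2_def)
    have kmono: "k * t \<le> k * card Y" if "t \<le> card Y" for t using that by simp
    \<comment> \<open>An end letter \<open>y\<close> prolongs the run \<open>u\<close> of
      \<open>y\<close>, and its block is charged to \<open>card Y\<close>; an end letter
      \<open>x\<close> contributes to a run inside \<open>f x @ f x\<close>, charged to
      \<open>card X\<close>.\<close>
    consider "c = x" "d = x" | "c = x" "d = y" | "c = y" "d = x" | "c = y" "d = y"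
      using letter_neq_unique[of _ x y] xy by blast
    then show ?thesis
    proof cases
      case 1
      have "f x @ f x = take (length p') (f x) @ replicate (e1 + e2) x @ drop e2 (f x)"
        using arg_cong2[where f = append, OF fc fd] by (simp only: 1 replicate_add append.assoc)
      from x_run[OF this] have "e1 + e2 \<le> card X" .
      moreover have "length u \<le> card Y" by (rule yrun[of "[c]" u "[d]"]) (use v2e setu in simp_all)
      from kmono[OF this] have "k * length u \<le> k * card Y" .
      ultimately show ?thesis using me by linarith
    next
      case 2
      have "f x @ f x = take (length p') (f x) @ replicate e1 x @ f x"
        using arg_cong2[where f = append, OF fc refl[of "f x"]] by (simp only: 2 append.assoc)
      from x_run[OF this] have "e1 \<le> card X" .
      moreover have "length (u @ [d]) \<le> card Y"
        by (rule yrun[of "[c]" "u @ [d]" "[]"]) (use v2e setu 2 in simp_all)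
      then have "Suc (length u) \<le> card Y" by simp
      from kmono[OF this] have "k + k * length u \<le> k * card Y" by (simp only: mult_Suc_right)
      ultimately show ?thesis using me ek by linarith
    next
      case 3
      have "f x @ f x = f x @ replicate e2 x @ drop e2 (f x)"
        using arg_cong2[where f = append, OF refl[of "f x"] fd] by (simp only: 3)
      from x_run[OF this] have "e2 \<le> card X" .
      moreover have "length (c # u) \<le> card Y"
        by (rule yrun[of "[]" "c # u" "[d]"]) (use v2e setu 3 in simp_all)
      then have "Suc (length u) \<le> card Y" by simp
      from kmono[OF this] have "k + k * length u \<le> k * card Y" by (simp only: mult_Suc_right)
      ultimately show ?thesis using me ek by linarith
    next
      case 4
      have "length v2 \<le> card Y" by (rule yrun[of "[]" v2 "[]"]) (use v2e setu 4 in simp_all)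
      then have "Suc (Suc (length u)) \<le> card Y" by (simp add: v2e)
      from kmono[OF this] have "k + (k + k * length u) \<le> k * card Y" by (simp only: mult_Suc_right)
      then show ?thesis using me ek by linarith
    qed
  qed
  also have "card X + k * card Y \<le> k * (l - 1) + 1"
  proof -
    obtain i where i: "card X = Suc i" using pos(1) by (cases "card X") auto
    then have "l - 1 = i + card Y" using XY by simp
    moreover have "i \<le> k * i" using k2 by simp
    ultimately show ?thesis using i by (simp add: distrib_left)
  qed
  finally show ?thesis by (simp add: l_def)
qed

text \<open>The two parts of \<open>f x\<close> commute, so they are powers of a common word, no
  longer than \<open>r\<close>.\<close>

lemma fixed_rotation_root:
  assumes "f x = drop r (f x) @ take r (f x)" "0 < r" "r < k"
  obtains w n where "f x = concat (replicate n w)" "length w < k" "k = n * length w"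
proof -
  have "take r (f x) @ drop r (f x) = drop r (f x) @ take r (f x)" using assms(1) by simp
  moreover have ne: "take r (f x) \<noteq> []" using assms(2,3) len[of x] by (metis gr_implies_not0 list.size(3) take_eq_Nil)
  ultimately obtain w m n where w: "w \<noteq> []" "take r (f x) = concat (replicate m w)"
    "take r (f x) @ drop r (f x) = concat (replicate n w)" by (rule comm_root)
  have fx: "f x = concat (replicate n w)" using w(3) by simp
  have r: "r = m * length w" using arg_cong[OF w(2), of length] assms(3) by (simp add: length_concat_replicate)
  then have "length w \<le> r" using assms(2) by (cases m) auto
  moreover have "k = n * length w" using arg_cong[OF fx, of length] by (simp add: length_concat_replicate)
  ultimately show thesis by (intro that[OF fx]) (use assms(3) in linarith)
qed

section \<open>Assembling the bounds\<close>

text \<open>A word longer than \<open>B\<close> has room for \<open>n\<close> blocks.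
  \<open>comp\<close> exceeds the run bound for every root length \<open>l\<close>, and
  \<open>comp2\<close> makes runs and alternating words long enough to contain a whole
  block.\<close>

lemma Z_min_bound:
  assumes n: "k + 3 \<le> n + 1" "k * n \<le> Suc B" and B: "k \<le> B"
    and comp: "\<And>l. \<not> prime k \<Longrightarrow> l dvd k \<Longrightarrow> l < k \<Longrightarrow> k * (l - 1) + 4 \<le> n"
    and comp2: "\<not> prime k \<Longrightarrow> 2 * k \<le> n"
  shows "Z_min f [a] \<le> B"
proof (rule Z_min_le[OF B])
  fix u v v' p p' s s'
  assume u: "B < length u" and v: "v \<in> SL f [a]" "morph f v = p @ u @ s"
    and v': "v' \<in> SL f [a]" "morph f v' = p' @ u @ s'"
    and p: "length p' < length p" "length p < k"
  have nu: "k * n \<le> length u" using n(2) u by linarith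
  have n3: "3 \<le> n" using n(1) k2 by linarith
  from v v' p nu n3 show False
  proof (cases rule: unsynchronized_cases)
    case (alternating w x y)
    have "prime k \<or> (\<exists>c. distinct_adj (f c))"
    proof (cases "prime k")
      case False
      have "2 \<le> length w" using alternating(3) n3 by simp
      from SL_interp[OF alternating(1) this] obtain q t z where z: "z \<in> SL f [a]" "morph f z = q @ w @ t" .
      have "2 * k - 1 \<le> length w" using comp2[OF False] alternating(3) by simp
      from contains_block[OF z(2) this] obtain c g h where "w = g @ f c @ h" .
      then have "distinct_adj (f c)" using alternating(2) distinct_adj_prefix distinct_adj_suffix by metis
      then show ?thesis by blast
    qed simp
    then show False using no_commuting_factorization[OF alternating(4-7)] by blast
  next
    case (letter_powers x y r)
    show False
    proof (cases "x = y")
      case False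
      \<comment> \<open>Contradiction, as \<open>k + 2 \<le> n\<close> makes the left side at least
        \<open>2 * k + 1\<close>.\<close>
      have "(n - 1) + (n - 2) \<le> 2 * k"
        by (rule rotated_images_bound[OF False letter_powers(3,4) _ letter_powers(5)]) (use n k2 in simp_all)
      then show False using n(1) by linarith
    next
      case True
      obtain w j where w: "f x = concat (replicate j w)" "length w < k" "k = j * length w"
        using fixed_rotation_root[of x r] letter_powers(1-3) True by blast
      have big: "2 \<le> n - 1" "\<not> n - 1 < k" using n k2 by linarith+
      have notpow: "f x \<noteq> replicate k z" for z
        using letter_power_run_bound[OF _ letter_powers(4) big(1)] big(2) by blast
      have fxw: "set (f x) \<subseteq> set w" using w(1) by (auto split: if_splits)
      have np: "\<not> prime k"
      proof
        assume "prime k"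
        moreover have "length w dvd k" using dvd_triv_right[of "length w" j] by (simp only: w(3))
        ultimately have "length w = 1" using w(2) prime_nat_iff[of k] by blast
        then obtain z where "w = [z]" by (auto simp: length_Suc_conv)
        then show False using fxw eq_replicate_iff[of x z] notpow by simp
      qed
      \<comment> \<open>The run of \<open>x\<close> contains a whole block, so some
        \<open>f c\<close> is \<open>replicate k x\<close>; this \<open>c\<close> is the other
        letter, as \<open>mixed_root_run_bound\<close> requires.\<close>
      obtain q t z where z: "z \<in> SL f [a]" "morph f z = q @ replicate (n - 1) x @ t"
        using SL_run_interp[OF letter_powers(4) big(1)] .
      have "2 * k - 1 \<le> length (replicate (n - 1) x)" using comp2[OF np] by simp
      from contains_block[OF z(2) this] obtain c g h where c: "replicate (n - 1) x = g @ f c @ h" .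
      have "set (f c) \<subseteq> {x}" using arg_cong[OF c, of set] by (auto simp: set_replicate_conv_if split: if_splits)
      then have fc: "f c = replicate k x" using eq_replicate_iff by blast
      then have cx: "x \<noteq> c" using notpow[of x] by auto
      have mem: "e \<in> set w" for e
      proof (rule ccontr)
        assume "e \<notin> set w"
        define z where "z = (if e = a then b else a)"
        have ze: "z \<noteq> e" by (simp add: z_def)
        have "set (f x) \<subseteq> {z}"
        proof
          fix g assume "g \<in> set (f x)"
          then have "g \<noteq> e" using fxw \<open>e \<notin> set w\<close> by blast
          then show "g \<in> {z}" using letter_neq_unique[of g e z] ze by simp
        qed
        then show False using notpow eq_replicate_iff by blast
      qed
      have "n - 1 \<le> k * (length w - 1) + 1"
        using mixed_root_run_bound[OF fc cx w(1) mem mem letter_powers(4) big(1)] .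
      moreover have "length w dvd k" using dvd_triv_right[of "length w" j] by (simp only: w(3))
      ultimately show False using comp[OF np _ w(2)] by fastforce
    qed
  qed
qed

end

theorem theorem1:
  fixes k :: nat and f :: "letter \<Rightarrow> letter list"
  assumes "k \<ge> 2"
    and "circular f [a]"
    and "uniform k f"
  defines "d \<equiv> LEAST d::nat. d > 1 \<and> d dvd k"
  shows "(k = 2 \<longrightarrow> Z_min f [a] \<le> 8)
    \<and> (prime k \<and> odd k \<longrightarrow> Z_min f [a] \<le> k^2 + 3*k - 4)
    \<and> (k \<noteq> 2 \<and> \<not> (prime k \<and> odd k) \<longrightarrow> Z_min f [a] \<le> k^2 * (k div d - 1) + 5*k - 4)"
proof -
  have len: "length (f c) = k" for c using assms(3) by (cases c) (auto simp: uniform_def)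
  interpret circular_uniform k f using assms(1,2) len by unfold_locales auto
  have two: "Z_min f [a] \<le> 8" if "k = 2"
    by (rule Z_min_bound[of 4]) (use that two_is_prime_nat in auto)
  moreover have "Z_min f [a] \<le> k^2 + 3*k - 4" if "prime k" "odd k"
  proof -
    \<comment> \<open>With \<open>n = k + 2\<close>, the condition \<open>k * n \<le> Suc B\<close>
      amounts to \<open>3 \<le> k\<close>.\<close>
    have "3 \<le> k" using that(2) assms(1) by (cases "k = 2") auto
    then show ?thesis
      by (intro Z_min_bound[of "k + 2"]) (use that in \<open>auto simp: power2_eq_square algebra_simps\<close>)
  qed
  moreover have "Z_min f [a] \<le> k^2 * (k div d - 1) + 5*k - 4" if "k \<noteq> 2" "\<not> (prime k \<and> odd k)"
  proof -
    have np: "\<not> prime k" using that prime_odd_nat[of k] assms(1) by auto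
    \<comment> \<open>\<open>q\<close> is the largest proper divisor of \<open>k\<close>, hence
      bounds every root length.\<close>
    define q where "q = k div d"
    have d: "1 < d" "d dvd k"
      using LeastI[of "\<lambda>d. d > 1 \<and> d dvd k" k] assms(1) by (auto simp: d_def)
    have dle: "d \<le> e" if "1 < e" "e dvd k" for e
      unfolding d_def by (rule Least_le) (use that in simp)
    have kq: "k = d * q" using d by (simp add: q_def)
    obtain e where e: "e dvd k" "e \<noteq> 1" "e \<noteq> k" using np assms(1) prime_nat_iff[of k] by auto
    have "e \<noteq> 0" using e(1) assms(1) by (intro notI) simp
    then have "1 < e" "e < k" using e assms(1) dvd_imp_le[of e k] by simp_all
    then have dk: "d < k" using dle[of e] e(1) by simp
    have "q \<noteq> 0" "q \<noteq> 1" using kq dk assms(1) by auto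
    then have q2: "2 \<le> q" by linarith
    have k4: "4 \<le> k" using mult_le_mono[of 2 d 2 q] d(1) q2 kq by simp
    have lq: "l \<le> q" if l: "l dvd k" "l < k" for l
    proof -
      obtain j where j: "k = l * j" using l(1) ..
      then have "j \<noteq> 0" "j \<noteq> 1" using l(2) assms(1) by auto
      then have "d \<le> j" using dle[of j] j by simp
      moreover have "l = k div j" using j \<open>j \<noteq> 0\<close> by simp
      ultimately show ?thesis unfolding q_def using d(1) by (simp add: div_le_mono2)
    qed
    \<comment> \<open>If \<open>q = 2\<close>, then \<open>d = 2\<close> and \<open>k = 4\<close>,
      where equality holds.\<close>
    have big: "2 * k \<le> k * (q - 1) + 4"
    proof (cases "q = 2")
      case True
      then have "d \<le> 2" using dle[of 2] kq by simp
      then show ?thesis using kq True by simp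
    next
      case False
      then have "2 \<le> q - 1" using q2 by linarith
      then have "k * 2 \<le> k * (q - 1)" by (rule mult_le_mono2)
      then show ?thesis by linarith
    qed
    have "Z_min f [a] \<le> k^2 * (q - 1) + 5*k - 4"
    proof (rule Z_min_bound[of "k * (q - 1) + 4"])
      have "k * 1 \<le> k * (q - 1)" using q2 by (intro mult_le_mono2) linarith
      then show "k + 3 \<le> k * (q - 1) + 4 + 1" by linarith
      show "k * (k * (q - 1) + 4) \<le> Suc (k\<^sup>2 * (q - 1) + 5 * k - 4)"
        using k4 by (simp add: distrib_left power2_eq_square)
      show "k \<le> k\<^sup>2 * (q - 1) + 5 * k - 4" using k4 by linarith
      show "k * (l - 1) + 4 \<le> k * (q - 1) + 4" if "l dvd k" "l < k" for l
        using lq[OF that] by (simp add: diff_le_mono)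
      show "2 * k \<le> k * (q - 1) + 4" by (rule big)
    qed
    then show ?thesis by (simp add: q_def)
  qed
  ultimately show ?thesis by blast
qed

end
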